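(* Let $\mathbf{W}\in\mathbb{R}^{n\times n}$ be symmetric positive semidefinite, stochastic and irreducible, let $\mathbf{A}\in\mathbb{R}^{m\times n}$ be the forward operator corresponding to inpainting, deblurring, or superresolution, and let $\boldsymbol{b}\in\mathbb{R}^m$ and $\lambda>0$. Then the objective function $$\boldsymbol{x}\mapsto \tfrac12\|\mathbf{A}\boldsymbol{x}-\boldsymbol{b}\|_2^2+\lambda\,\varphi_{\mathbf{W}}(\boldsymbol{x}),\qquad \varphi_{\mathbf{W}}(\boldsymbol{x})=\tfrac12\boldsymbol{x}^\top\mathbf{W}^{\dagger}(\mathbf{I}-\mathbf{W})\boldsymbol{x}+\iota_{\mathcal{R}(\mathbf{W})}(\boldsymbol{x}),$$ is strongly convex on $(\mathbb{R}^n,\langle\cdot,\cdot\rangle_2)$.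
   Context: $\langle\boldsymbol{x},\boldsymbol{y}\rangle_2=\boldsymbol{x}^\top\boldsymbol{y}$. Stochastic means entrywise nonnegative with $\mathbf{W}\boldsymbol{e}=\boldsymbol{e}$, $\boldsymbol{e}$ the all-ones vector. $\mathbf{W}^\dagger$ is the Moore–Penrose pseudoinverse, $\mathcal{R}(\mathbf{W})$ the range, and $\iota_\Omega$ equals $0$ on $\Omega$ and $+\infty$ off $\Omega$. Forward operators (images with $n$ pixels are vectors in $\mathbb{R}^n$). Inpainting: $\mathbf{A}$ is a sampling operator returning the values of a subset of the pixels, at least one pixel being sampled. Deblurring: $\mathbf{A}$ is a blur, i.e. convolution with a finitely supported nonnegative nonzero kernel $k$, $(\mathbf{A}\boldsymbol{x})_i=\sum_s k(s)\,\tilde x_{i-s}$, where $\tilde x$ extends the image $\boldsymbol{x}$ outside its domain by a fixed rule assigning to each outside pixel the value of some pixel of $\boldsymbol{x}$ (e.g. periodic, symmetric or replicate extension). Superresolution: $\mathbf{A}$ is such a blur followed by subsampling of a nonempty set of pixels. A proper, closed, convex function $f:\mathbb{R}^n\to(-\infty,\infty]$ is strongly convex on a Euclidean space $(\mathbb{R}^n,\langle\cdot,\cdot\rangle)$ with induced norm $\|\cdot\|$ if there exists $\mu>0$ such that for all $\boldsymbol{x},\boldsymbol{y}\in\mathbb{R}^n$ and $\theta\in[0,1]$, $$f(\theta\boldsymbol{x}+(1-\theta)\boldsymbol{y})\le\theta f(\boldsymbol{x})+(1-\theta)f(\boldsymbol{y})-\tfrac{\mu}{2}\theta(1-\theta)\|\boldsymbol{x}-\boldsymbol{y}\|^2.$$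 *)

theory Defs
  imports "HOL-Analysis.Analysis"
begin

section \<open>Matrices\<close>

definition psd_matrix :: "real^'n^'n \<Rightarrow> bool" where
  "psd_matrix W \<longleftrightarrow> transpose W = W \<and> (\<forall>x. 0 \<le> x \<bullet> (W *v x))"

text \<open>\<^term>\<open>1 :: real^'n\<close> is the all-ones vector; the identity matrix is \<^term>\<open>mat 1 :: real^'n^'n\<close>.\<close>

definition stochastic_matrix :: "real^'n^'n \<Rightarrow> bool" where
  "stochastic_matrix W \<longleftrightarrow> (\<forall>i j. 0 \<le> W $ i $ j) \<and> W *v 1 = 1"

text \<open>No simultaneous permutation of rows and columns brings the matrix to block triangular
  form with two nonempty square diagonal blocks; \<open>S\<close> is the set of indices of the lower block.\<close>

definition irreducible_matrix :: "real^'n^'n \<Rightarrow> bool" where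
  "irreducible_matrix W \<longleftrightarrow>
     \<not> (\<exists>S. S \<noteq> {} \<and> S \<noteq> UNIV \<and> (\<forall>i\<in>S. \<forall>j\<in>- S. W $ i $ j = 0))"

definition is_pinv :: "real^'n^'m \<Rightarrow> real^'m^'n \<Rightarrow> bool" where
  "is_pinv A X \<longleftrightarrow> A ** X ** A = A \<and> X ** A ** X = X \<and>
     transpose (A ** X) = A ** X \<and> transpose (X ** A) = X ** A"

definition pinv :: "real^'n^'m \<Rightarrow> real^'m^'n" where
  "pinv A = (THE X. is_pinv A X)"

lemma is_pinv_unique:
  assumes "is_pinv A X" "is_pinv A Y"
  shows "X = Y"
proof -
  have XA: "X ** A = Y ** A"
  proof -
    have "X ** A = transpose (X ** (A ** Y ** A))"
      using assms by (simp add: is_pinv_def)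
    also have "\<dots> = transpose ((X ** A) ** (Y ** A))"
      by (simp add: matrix_mul_assoc)
    also have "\<dots> = (Y ** A) ** (X ** A)"
      using assms by (simp add: is_pinv_def matrix_transpose_mul)
    also have "\<dots> = Y ** (A ** X ** A)"
      by (simp add: matrix_mul_assoc)
    finally show ?thesis using assms by (simp add: is_pinv_def)
  qed
  have AX: "A ** X = A ** Y"
  proof -
    have "A ** X = transpose ((A ** Y ** A) ** X)"
      using assms by (simp add: is_pinv_def)
    also have "\<dots> = transpose ((A ** Y) ** (A ** X))"
      by (simp add: matrix_mul_assoc)
    also have "\<dots> = (A ** X) ** (A ** Y)"
      using assms by (simp add: is_pinv_def matrix_transpose_mul)
    also have "\<dots> = (A ** X ** A) ** Y"
      by (simp add: matrix_mul_assoc)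
    finally show ?thesis using assms by (simp add: is_pinv_def)
  qed
  have "X = X ** A ** X" using assms by (simp add: is_pinv_def)
  also have "\<dots> = Y ** (A ** X)" by (simp add: XA matrix_mul_assoc)
  also have "\<dots> = Y ** A ** Y" by (simp add: AX matrix_mul_assoc)
  finally show ?thesis using assms by (simp add: is_pinv_def)
qed

lemma is_pinv_exists: "\<exists>X. is_pinv (A :: real^'n^'m) X"
proof -
  have transpose_inner: "(transpose M *v x) \<bullet> y = x \<bullet> (M *v y)"
    for M :: "real^'a^'b" and x y
    using dot_lmul_matrix[of x M y] by simp
  have sym: "transpose M = M" if "\<And>x y. (M *v x) \<bullet> y = x \<bullet> (M *v y)" for M :: "real^'a^'a"
  proof -
    have "transpose M *v x = M *v x" for x
      by (rule vector_eq_ldot[THEN iffD1]) (metis that transpose_inner inner_commute)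
    then show ?thesis by (simp add: matrix_eq)
  qed
  have projection: "\<exists>P :: real^'a^'a. (\<forall>x. P *v x \<in> V) \<and> (\<forall>x\<in>V. P *v x = x) \<and>
      (\<forall>x. \<forall>v\<in>V. (x - P *v x) \<bullet> v = 0) \<and> transpose P = P"
    if V: "subspace V" for V :: "(real^'a) set"
  proof -
    have "\<exists>p. p \<in> V \<and> (\<forall>v\<in>V. (x - p) \<bullet> v = 0)" for x
    proof -
      obtain y z where "y \<in> span V" "\<And>w. w \<in> span V \<Longrightarrow> orthogonal z w" "x = y + z"
        using orthogonal_subspace_decomp_exists[of V x] by metis
      then show ?thesis
        using V by (intro exI[of _ y]) (auto simp: orthogonal_def span_eq_iff[THEN iffD2])
    qed
    then obtain p where p: "\<And>x. p x \<in> V" "\<And>x v. v \<in> V \<Longrightarrow> (x - p x) \<bullet> v = 0"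
      by metis
    have uniq: "p x = q" if "q \<in> V" "\<And>v. v \<in> V \<Longrightarrow> (x - q) \<bullet> v = 0" for x q
    proof -
      have "p x - q \<in> V" using p(1) that(1) V by (simp add: subspace_diff)
      then have "(p x - q) \<bullet> (p x - q) = 0"
        using p(2)[of "p x - q" x] that(2)[of "p x - q"] by (simp add: inner_diff_left)
      then show ?thesis by simp
    qed
    have "linear p"
    proof (rule linearI)
      show "p (x + y) = p x + p y" for x y
      proof (rule uniq)
        fix v assume "v \<in> V"
        then show "(x + y - (p x + p y)) \<bullet> v = 0"
          using p(2)[of v x] p(2)[of v y] by (simp add: inner_diff_left inner_add_left)
      qed (simp add: V p subspace_add)
      show "p (c *\<^sub>R x) = c *\<^sub>R p x" for c x
      proof (rule uniq)
        fix v assume "v \<in> V"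
        then show "(c *\<^sub>R x - c *\<^sub>R p x) \<bullet> v = 0"
          using p(2)[of v x] by (simp add: inner_diff_left)
      qed (simp add: V p subspace_scale)
    qed
    then have M: "matrix p *v x = p x" for x by (simp add: matrix_works)
    have "transpose (matrix p) = matrix p"
    proof (rule sym)
      fix x y
      have "(x - p x) \<bullet> p y = 0" "(y - p y) \<bullet> p x = 0" using p by auto
      then show "(matrix p *v x) \<bullet> y = x \<bullet> (matrix p *v y)"
        by (simp add: M inner_diff_left inner_commute[of "p x" y] inner_commute[of "p y" "p x"])
    qed
    moreover have "p x = x" if "x \<in> V" for x using uniq[of x x] that by simp
    ultimately show ?thesis
      by (intro exI[of _ "matrix p"]) (simp add: M p)
  qed
  define V where "V = range ((*v) (transpose A))"
  have V: "subspace V" unfolding V_def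
    by (intro linear_subspace_image subspace_UNIV) simp
  obtain P where P: "\<And>y. P *v y \<in> range ((*v) A)" "\<And>y. y \<in> range ((*v) A) \<Longrightarrow> P *v y = y"
    "transpose P = P"
    using projection[of "range ((*v) A)"] by (auto simp: linear_subspace_image subspace_UNIV)
  obtain Q where Q: "\<And>x. Q *v x \<in> V" "\<And>x. x \<in> V \<Longrightarrow> Q *v x = x"
    "\<And>x v. v \<in> V \<Longrightarrow> (x - Q *v x) \<bullet> v = 0" "transpose Q = Q"
    using projection[OF V] by metis
  have AQ: "A *v (Q *v x) = A *v x" for x
  proof -
    have "(A *v (x - Q *v x)) \<bullet> y = 0" for y
      using Q(3)[of "transpose A *v y" x] transpose_inner[of A y "x - Q *v x"]
      by (simp add: V_def inner_commute)
    then have "A *v (x - Q *v x) = 0" by (metis inner_eq_zero_iff)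
    then show ?thesis by (simp add: matrix_vector_mult_diff_distrib)
  qed
  have "inj_on ((*v) A) V"
  proof (rule inj_onI)
    fix x y assume xy: "x \<in> V" "y \<in> V" "A *v x = A *v y"
    then have "x - y \<in> V" using V by (simp add: subspace_diff)
    then obtain z where z: "x - y = transpose A *v z" by (auto simp: V_def)
    have "(x - y) \<bullet> (x - y) = z \<bullet> (A *v (x - y))"
      by (subst (1) z) (rule transpose_inner)
    then show "x = y" using xy(3) by (simp add: matrix_vector_mult_diff_distrib)
  qed
  then obtain g where g: "linear g" "range g \<subseteq> V" "\<And>x. x \<in> V \<Longrightarrow> g (A *v x) = x"
    using linear_exists_left_inverse_on[of "(*v) A" V] V by auto
  define X where "X = matrix g ** P"
  have X: "X *v y = g (P *v y)" for y
    using g(1) by (simp add: X_def matrix_works flip: matrix_vector_mul_assoc)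
  have Ag: "A *v g y = y" if "y \<in> range ((*v) A)" for y
    using that g(3) Q(1) AQ by (metis rangeE)
  have gA: "g (A *v x) = Q *v x" for x
    using g(3)[OF Q(1)] AQ by metis
  have AX: "A ** X = P"
    by (simp add: matrix_eq X Ag P flip: matrix_vector_mul_assoc)
  have XA: "X ** A = Q"
    by (simp add: matrix_eq X P gA flip: matrix_vector_mul_assoc)
  have "A ** X ** A = A"
    by (simp add: AX matrix_eq P flip: matrix_vector_mul_assoc)
  moreover have "X ** A ** X = X"
    using g(2) Q(2) by (simp add: XA matrix_eq X range_subsetD flip: matrix_vector_mul_assoc)
  ultimately have "is_pinv A X"
    by (simp add: is_pinv_def AX XA P Q)
  then show ?thesis by blast
qed

lemma is_pinv_pinv: "is_pinv A (pinv A)"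
  unfolding pinv_def using is_pinv_exists[of A] is_pinv_unique by (metis (mono_tags) theI)


section \<open>Forward operators\<close>

text \<open>The pixels are indexed by \<open>'n\<close>; the injective map \<open>loc\<close> places them on the grid of integer
  points of dimension \<open>CARD('d)\<close>, so \<open>range loc\<close> is the image domain. The rule \<open>r\<close> names, for
  each grid point outside the domain, the pixel whose value it receives.\<close>

definition extend_image ::
    "('n \<Rightarrow> int^'d) \<Rightarrow> (int^'d \<Rightarrow> 'n) \<Rightarrow> real^'n \<Rightarrow> int^'d \<Rightarrow> real" where
  "extend_image loc r x p = (if p \<in> range loc then x $ (inv loc p) else x $ (r p))"

definition is_blur :: "('n \<Rightarrow> int^'d) \<Rightarrow> real^'n^'n \<Rightarrow> bool" where
  "is_blur loc B \<longleftrightarrow>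
     (\<exists>(k :: int^'d \<Rightarrow> real) r.
        finite {s. k s \<noteq> 0} \<and> (\<forall>s. 0 \<le> k s) \<and> (\<exists>s. k s \<noteq> 0) \<and>
        (\<forall>x i. (B *v x) $ i = (\<Sum>s | k s \<noteq> 0. k s * extend_image loc r x (loc i - s))))"

text \<open>The sampled set is \<open>range \<sigma>\<close>, enumerated without repetition by the row index type \<open>'m\<close>.
  It is nonempty since every type is.\<close>

definition sampling_matrix :: "('m \<Rightarrow> 'n) \<Rightarrow> real^'n^'m" where
  "sampling_matrix \<sigma> = (\<chi> j i. if i = \<sigma> j then 1 else 0)"

definition inpainting_op :: "real^'n^'m \<Rightarrow> bool" where
  "inpainting_op A \<longleftrightarrow> (\<exists>\<sigma>. inj \<sigma> \<and> A = sampling_matrix \<sigma>)"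

text \<open>A blur returns as many values as there are pixels: its row index type \<open>'m\<close> is identified
  with the pixel index type \<open>'n\<close> by a bijection. For \<open>'m = 'n\<close> and \<open>\<sigma> = id\<close> this is
  \<^prop>\<open>is_blur loc A\<close>.\<close>

definition deblurring_op :: "('n \<Rightarrow> int^'d) \<Rightarrow> real^'n^'m \<Rightarrow> bool" where
  "deblurring_op loc A \<longleftrightarrow>
     (\<exists>\<sigma> B. bij \<sigma> \<and> is_blur loc B \<and> A = sampling_matrix \<sigma> ** B)"

definition superresolution_op :: "('n \<Rightarrow> int^'d) \<Rightarrow> real^'n^'m \<Rightarrow> bool" where
  "superresolution_op loc A \<longleftrightarrow>
     (\<exists>\<sigma> B. inj \<sigma> \<and> is_blur loc B \<and> A = sampling_matrix \<sigma> ** B)"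


section \<open>Extended-valued convex functions\<close>

definition epi :: "('a \<Rightarrow> ereal) \<Rightarrow> ('a \<times> real) set" where
  "epi f = {(x, t). f x \<le> ereal t}"

definition proper_fun :: "('a \<Rightarrow> ereal) \<Rightarrow> bool" where
  "proper_fun f \<longleftrightarrow> (\<forall>x. f x \<noteq> -\<infinity>) \<and> (\<exists>x. f x \<noteq> \<infinity>)"

definition closed_fun :: "('a::euclidean_space \<Rightarrow> ereal) \<Rightarrow> bool" where
  "closed_fun f \<longleftrightarrow> closed (epi f)"

definition convex_fun :: "('a::euclidean_space \<Rightarrow> ereal) \<Rightarrow> bool" where
  "convex_fun f \<longleftrightarrow> convex (epi f)"

text \<open>In \<^typ>\<open>ereal\<close>, \<open>0 * \<infinity> = 0\<close>, so the inequality is harmless at \<open>\<theta> = 0\<close> and \<open>\<theta> = 1\<close>.\<close>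

definition strongly_convex :: "('a::euclidean_space \<Rightarrow> ereal) \<Rightarrow> bool" where
  "strongly_convex f \<longleftrightarrow> proper_fun f \<and> closed_fun f \<and> convex_fun f \<and>
     (\<exists>\<mu>::real. \<mu> > 0 \<and> (\<forall>x y. \<forall>\<theta>\<in>{0..1}.
        f (\<theta> *\<^sub>R x + (1 - \<theta>) *\<^sub>R y)
          \<le> ereal \<theta> * f x + ereal (1 - \<theta>) * f y
             - ereal (\<mu> / 2 * \<theta> * (1 - \<theta>) * (norm (x - y))\<^sup>2)))"

definition indicator_fun :: "'a set \<Rightarrow> 'a \<Rightarrow> ereal" where
  "indicator_fun \<Omega> x = (if x \<in> \<Omega> then 0 else \<infinity>)"

definition \<phi> :: "real^'n^'n \<Rightarrow> real^'n \<Rightarrow> ereal" where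
  "\<phi> W x = ereal (1/2 * (x \<bullet> ((pinv W ** (mat 1 - W)) *v x)))
              + indicator_fun (range ((*v) W)) x"

end

theory Submission
  imports Defs
begin

text \<open>On the range of \<open>W\<close> put \<open>y = W\<^sup>\<dagger> x\<close>, so that \<open>x = W y\<close> and the quadratic form of
  \<open>\<phi>\<close> is \<open>y \<bullet> W y - x \<bullet> x\<close>. Expanding \<open>0 \<le> (y - x) \<bullet> W (y - x)\<close> bounds it below by
  \<open>x \<bullet> x - x \<bullet> W x\<close>, which for a symmetric stochastic \<open>W\<close> is the Dirichlet form
  \<open>1/2 * (\<Sum>i j. W\<^sub>i\<^sub>j * (x\<^sub>i - x\<^sub>j)\<^sup>2)\<close>. By irreducibility that vanishes only on constant vectors,
  and a forward operator maps no nonzero constant vector to zero. Hence the quadratic part of the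
  objective dominates a positive definite form, and compactness of the sphere gives the modulus.\<close>

section \<open>Strong convexity of a real function restricted to a convex set\<close>

lemma inner_transpose_matrix_vector:
  fixes M :: "real^'a^'b"
  shows "(transpose M *v x) \<bullet> y = x \<bullet> (M *v y)"
  using dot_lmul_matrix[of x M y] by simp

text \<open>The epigraph of the sum is that of \<open>h\<close> cut down to
  \<open>V \<times> UNIV\<close>, so closedness follows from continuity of \<open>h\<close>. What
  remains for the objective is a real inequality on \<open>V\<close>.\<close>

lemma strongly_convex_add_indicator:
  fixes h :: "'a::euclidean_space \<Rightarrow> real"
  assumes "continuous_on UNIV h" and "closed V" and "convex V" and "V \<noteq> {}" and "\<mu> > 0"
    and h: "\<And>x y \<theta>. x \<in> V \<Longrightarrow> y \<in> V \<Longrightarrow> \<theta> \<in> {0..1} \<Longrightarrow>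
      h (\<theta> *\<^sub>R x + (1 - \<theta>) *\<^sub>R y)
        \<le> \<theta> * h x + (1 - \<theta>) * h y - \<mu> / 2 * \<theta> * (1 - \<theta>) * (norm (x - y))\<^sup>2"
  shows "strongly_convex (\<lambda>x. ereal (h x) + indicator_fun V x)"
proof -
  define f where "f = (\<lambda>x. ereal (h x) + indicator_fun V x)"
  have f_in: "f x = ereal (h x)" if "x \<in> V" for x
    using that by (simp add: f_def indicator_fun_def)
  have f_out: "f x = \<infinity>" if "x \<notin> V" for x
    using that by (simp add: f_def indicator_fun_def)
  have V_comb: "\<theta> *\<^sub>R x + (1 - \<theta>) *\<^sub>R y \<in> V" if "x \<in> V" "y \<in> V" "\<theta> \<in> {0..1}" for x y \<theta>
    using that \<open>convex V\<close> by (auto simp: convex_def)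
  have epi: "epi f = (V \<times> UNIV) \<inter> {p. h (fst p) \<le> snd p}"
    by (auto simp: epi_def) (metis f_in f_out ereal_less_eq(3) PInfty_neq_ereal(1) ereal_infty_less_eq(1))+
  have "proper_fun f"
    using f_in f_out \<open>V \<noteq> {}\<close> unfolding proper_fun_def
    by (metis MInfty_neq_ereal(1) MInfty_neq_PInfty(1) PInfty_neq_ereal(1) ex_in_conv)
  moreover have "closed_fun f"
    unfolding closed_fun_def epi
    by (intro closed_Int closed_Times closed_UNIV \<open>closed V\<close> closed_Collect_le
        continuous_on_compose2[OF assms(1)] continuous_intros) auto
  moreover have "convex_fun f"
    unfolding convex_fun_def epi convex_alt
  proof (intro ballI allI impI)
    fix p q u
    assume pq: "p \<in> V \<times> UNIV \<inter> {p. h (fst p) \<le> snd p}" "q \<in> V \<times> UNIV \<inter> {p. h (fst p) \<le> snd p}"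
      and u: "0 \<le> u \<and> u \<le> (1::real)"
    then have V: "fst p \<in> V" "fst q \<in> V" and le: "h (fst p) \<le> snd p" "h (fst q) \<le> snd q"
      by auto
    \<comment> \<open>\<open>convex_alt\<close> puts the weight \<open>u\<close> on the second
      point, so \<open>q\<close> takes the role of \<open>x\<close>.\<close>
    have "h (u *\<^sub>R fst q + (1 - u) *\<^sub>R fst p)
        \<le> u * h (fst q) + (1 - u) * h (fst p) - \<mu> / 2 * u * (1 - u) * (norm (fst q - fst p))\<^sup>2"
      using h V u by simp
    also have "\<dots> \<le> u * h (fst q) + (1 - u) * h (fst p)"
      using u \<open>\<mu> > 0\<close> by simp
    also have "\<dots> \<le> u * snd q + (1 - u) * snd p"
      using u le by (intro add_mono mult_left_mono) auto
    finally show "(1 - u) *\<^sub>R p + u *\<^sub>R q \<in> V \<times> UNIV \<inter> {p. h (fst p) \<le> snd p}"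
      using V_comb[OF V(2,1), of u] u by (auto simp: mem_Times_iff add.commute)
  qed
  moreover have "f (\<theta> *\<^sub>R x + (1 - \<theta>) *\<^sub>R y)
      \<le> ereal \<theta> * f x + ereal (1 - \<theta>) * f y - ereal (\<mu> / 2 * \<theta> * (1 - \<theta>) * (norm (x - y))\<^sup>2)"
    if \<theta>: "\<theta> \<in> {0..1}" for x y \<theta>
  proof -
    \<comment> \<open>The endpoints are split off because \<open>0 * \<infinity> = 0\<close> there;
      strictly between them, a point off \<open>V\<close> makes the right-hand side
      infinite.\<close>
    consider "\<theta> = 0" | "\<theta> = 1" | "0 < \<theta>" "\<theta> < 1" "x \<in> V" "y \<in> V"
      | "0 < \<theta>" "\<theta> < 1" "x \<notin> V \<or> y \<notin> V"
      using \<theta> by force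
    then show ?thesis
    proof cases
      case 3
      then show ?thesis
        using h[of x y \<theta>] V_comb[of x y \<theta>] by (simp add: f_in)
    next
      case 4
      then have top: "ereal \<theta> * f x + ereal (1 - \<theta>) * f y = \<infinity>"
        by (cases "x \<in> V"; cases "y \<in> V") (auto simp: f_in f_out)
      then show ?thesis unfolding top by simp
    qed (simp_all add: zero_ereal_def[symmetric] one_ereal_def[symmetric])
  qed
  ultimately show ?thesis
    using \<open>\<mu> > 0\<close> unfolding strongly_convex_def f_def[symmetric] by blast
qed

section \<open>Convexity gaps and coercivity of quadratic forms\<close>

text \<open>The two cross terms match separately, so the identity covers
  \<open>pinv W ** (mat 1 - W)\<close> without first showing that matrix symmetric.\<close>

lemma quadratic_form_convex_combination:
  fixes G :: "real^'n^'n"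
  shows "(\<theta> *\<^sub>R x + (1 - \<theta>) *\<^sub>R y) \<bullet> (G *v (\<theta> *\<^sub>R x + (1 - \<theta>) *\<^sub>R y)) =
    \<theta> * (x \<bullet> (G *v x)) + (1 - \<theta>) * (y \<bullet> (G *v y)) - \<theta> * (1 - \<theta>) * ((x - y) \<bullet> (G *v (x - y)))"
  by (simp add: matrix_vector_right_distrib matrix_vector_mult_diff_distrib
      matrix_vector_mult_scaleR inner_simps algebra_simps)

lemma norm_diff_power2_convex_combination:
  fixes u v b :: "'a::real_inner"
  shows "(norm (\<theta> *\<^sub>R u + (1 - \<theta>) *\<^sub>R v - b))\<^sup>2 =
    \<theta> * (norm (u - b))\<^sup>2 + (1 - \<theta>) * (norm (v - b))\<^sup>2 - \<theta> * (1 - \<theta>) * (norm (u - v))\<^sup>2"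
  by (simp add: power2_norm_eq_inner inner_simps inner_commute algebra_simps)

text \<open>The minimum over the compact unit sphere is positive, and homogeneity of degree two
  carries it to all vectors.\<close>

lemma positive_form_coercive:
  fixes p :: "'a::euclidean_space \<Rightarrow> real"
  assumes "continuous_on UNIV p" and scale: "\<And>c x. p (c *\<^sub>R x) = c\<^sup>2 * p x"
    and pos: "\<And>x. x \<noteq> 0 \<Longrightarrow> 0 < p x"
  obtains \<mu> where "\<mu> > 0" "\<And>x. \<mu> * (norm x)\<^sup>2 \<le> p x"
proof -
  have "continuous_on (sphere 0 1) p"
    using assms(1) continuous_on_subset by blast
  moreover have "sphere (0::'a) 1 \<noteq> {}"
    by simp
  ultimately obtain z where z: "z \<in> sphere 0 1" "\<And>x. x \<in> sphere 0 1 \<Longrightarrow> p z \<le> p x"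
    using continuous_attains_inf[OF compact_sphere] by metis
  show ?thesis
  proof
    show "p z > 0"
      using z(1) by (intro pos) auto
    fix x
    show "p z * (norm x)\<^sup>2 \<le> p x"
    proof (cases "x = 0")
      case True
      then show ?thesis using scale[of 0 0] by simp
    next
      case False
      then have "p z * (norm x)\<^sup>2 \<le> p (x /\<^sub>R norm x) * (norm x)\<^sup>2"
        by (intro mult_right_mono z) auto
      also have "\<dots> = p x"
        using False by (simp add: scale field_simps)
      finally show ?thesis .
    qed
  qed
qed

section \<open>The Dirichlet form and its comparison with the pseudoinverse form\<close>

text \<open>Expand the square: row sums equal to one turn the first square term into
  \<open>x \<bullet> x\<close>, and symmetry does the same for the second.\<close>

lemma dirichlet_form:
  fixes W :: "real^'n^'n"
  assumes sym: "transpose W = W" and row: "W *v 1 = 1"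
  shows "x \<bullet> x - x \<bullet> (W *v x) = 1/2 * (\<Sum>i\<in>UNIV. \<Sum>j\<in>UNIV. W $ i $ j * (x $ i - x $ j)\<^sup>2)"
proof -
  have rowsum: "(\<Sum>j\<in>UNIV. W $ i $ j) = 1" for i
    using arg_cong[OF row, of "\<lambda>v. v $ i"] by (simp add: matrix_vector_mult_def)
  have W_sym: "W $ j $ i = W $ i $ j" for i j
    using arg_cong[OF sym, of "\<lambda>M. M $ i $ j"] by (simp add: transpose_def)
  have "(\<Sum>i\<in>UNIV. \<Sum>j\<in>UNIV. W $ i $ j * (x $ i * x $ i)) = x \<bullet> x"
    by (simp add: sum_distrib_right[symmetric] rowsum inner_vec_def)
  moreover from this have "(\<Sum>i\<in>UNIV. \<Sum>j\<in>UNIV. W $ i $ j * (x $ j * x $ j)) = x \<bullet> x"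
    by (subst sum.swap) (simp add: W_sym)
  moreover have "(\<Sum>i\<in>UNIV. \<Sum>j\<in>UNIV. W $ i $ j * (x $ i * x $ j)) = x \<bullet> (W *v x)"
    by (simp add: inner_vec_def matrix_vector_mult_def sum_distrib_left mult_ac)
  moreover have "W $ i $ j * (x $ i - x $ j)\<^sup>2 = W $ i $ j * (x $ i * x $ i)
      + W $ i $ j * (x $ j * x $ j) - 2 * (W $ i $ j * (x $ i * x $ j))" for i j
    by (simp add: power2_eq_square algebra_simps)
  ultimately show ?thesis
    by (simp add: sum.distrib sum_subtractf sum_distrib_left[symmetric])
qed

lemma dirichlet_form_nonneg:
  fixes W :: "real^'n^'n"
  assumes "transpose W = W" and "stochastic_matrix W"
  shows "0 \<le> x \<bullet> x - x \<bullet> (W *v x)"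
  using assms by (simp add: dirichlet_form stochastic_matrix_def sum_nonneg)

lemma dirichlet_form_eq_0_imp_constant:
  fixes W :: "real^'n^'n"
  assumes "transpose W = W" and W: "stochastic_matrix W" and "irreducible_matrix W"
    and "x \<bullet> x - x \<bullet> (W *v x) = 0"
  obtains c where "x = c *\<^sub>R 1"
proof -
  have nonneg: "0 \<le> W $ i $ j * (x $ i - x $ j)\<^sup>2" for i j
    using W by (simp add: stochastic_matrix_def)
  have "(\<Sum>i\<in>UNIV. \<Sum>j\<in>UNIV. W $ i $ j * (x $ i - x $ j)\<^sup>2) = 0"
    using assms by (simp add: dirichlet_form stochastic_matrix_def)
  then have "W $ i $ j * (x $ i - x $ j)\<^sup>2 = 0" for i j
    using nonneg by (simp add: sum_nonneg_eq_0_iff sum_nonneg)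
  then have edge: "x $ i = x $ j" if "W $ i $ j \<noteq> 0" for i j
    using that by (metis mult_eq_0_iff power2_eq_square right_minus_eq)
  define i0 :: 'n where "i0 = undefined"
  \<comment> \<open>By \<open>edge\<close>, all entries of \<open>W\<close> from this level set to
    its complement vanish. The set contains \<open>i0\<close>, so irreducibility leaves no proper
    subset.\<close>
  have "{i. x $ i = x $ i0} = UNIV"
    using \<open>irreducible_matrix W\<close> edge unfolding irreducible_matrix_def
    by (metis (mono_tags, lifting) ComplD empty_iff mem_Collect_eq)
  then have "x = (x $ i0) *\<^sub>R 1"
    by (auto simp: vec_eq_iff)
  then show ?thesis by (rule that)
qed

text \<open>On an eigenvector with eigenvalue \<open>s > 0\<close> this is
  \<open>(1 - s) / s - (1 - s) = (1 - s)^2 / s \<ge> 0\<close>; the proof reaches it without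
  diagonalizing.\<close>

lemma pinv_form_ge_dirichlet_form:
  fixes W :: "real^'n^'n"
  assumes W: "psd_matrix W" and x: "x \<in> range ((*v) W)"
  shows "x \<bullet> x - x \<bullet> (W *v x) \<le> x \<bullet> ((pinv W ** (mat 1 - W)) *v x)"
proof -
  define X where "X = pinv W"
  have X: "W ** X ** W = W" "transpose (X ** W) = X ** W"
    using is_pinv_pinv[of W] by (simp_all add: is_pinv_def X_def)
  have sym: "transpose W = W" and psd: "\<And>v. 0 \<le> v \<bullet> (W *v v)"
    using W by (simp_all add: psd_matrix_def)
  obtain u where u: "x = W *v u"
    using x by blast
  define y where "y = X *v x"
  have Wy: "W *v y = x"
    by (simp add: y_def u matrix_vector_mul_assoc matrix_mul_assoc X(1))
  \<comment> \<open>With \<open>W\<close> and \<open>X ** W\<close> symmetric, transposing moves the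
    pseudoinverse to the left, so \<open>X ** W\<close> fixes the range of \<open>W\<close>.\<close>
  have "transpose (W ** (X ** W)) = transpose W"
    by (simp add: X(1) matrix_mul_assoc)
  then have "X ** W ** W = W"
    by (simp add: matrix_transpose_mul[of W "X ** W"] X(2) sym)
  then have "X *v (W *v x) = x"
    by (simp add: u matrix_vector_mul_assoc matrix_mul_assoc)
  then have form: "x \<bullet> ((X ** (mat 1 - W)) *v x) = x \<bullet> y - x \<bullet> x"
    by (simp add: matrix_vector_mul_assoc[symmetric] matrix_vector_mult_diff_rdistrib
        matrix_vector_mult_diff_distrib y_def inner_diff_right)
  have "y \<bullet> (W *v x) = x \<bullet> x"
    using inner_transpose_matrix_vector[of W y x] by (simp add: sym Wy)
  then have "(y - x) \<bullet> (W *v (y - x)) = x \<bullet> y - 2 * (x \<bullet> x) + x \<bullet> (W *v x)"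
    by (simp add: matrix_vector_mult_diff_distrib Wy inner_simps inner_commute[of y x])
  then show ?thesis
    using psd[of "y - x"] form by (simp add: X_def)
qed

section \<open>Forward operators on constant vectors\<close>

lemma sampling_matrix_mult_vector: "(sampling_matrix \<sigma> *v x) $ j = x $ (\<sigma> j)"
  by (simp add: sampling_matrix_def matrix_vector_mult_def if_distrib if_distribR cong: if_cong)

text \<open>Every extension rule extends the all-ones image by ones, so \<open>c\<close> is the
  total mass of the kernel.\<close>

lemma blur_one:
  assumes "is_blur loc B"
  obtains c where "c > 0" "B *v 1 = c *\<^sub>R 1"
proof -
  obtain k r where k: "finite {s. k s \<noteq> 0}" "\<And>s. 0 \<le> k s" "\<exists>s. k s \<noteq> 0"
    and B: "\<And>x i. (B *v x) $ i = (\<Sum>s | k s \<noteq> 0. k s * extend_image loc r x (loc i - s))"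
    using assms unfolding is_blur_def by blast
  have "0 < (\<Sum>s | k s \<noteq> 0. k s)"
    using k by (intro sum_pos) (auto simp: order_less_le)
  moreover have "B *v 1 = (\<Sum>s | k s \<noteq> 0. k s) *\<^sub>R 1"
    by (simp add: vec_eq_iff B extend_image_def one_index cong: if_cong)
  ultimately show ?thesis by (rule that)
qed

text \<open>Constants are the directions that the Dirichlet form cannot see, so there the data term
  has to supply the curvature.\<close>

lemma forward_op_one:
  assumes "inpainting_op A \<or> deblurring_op loc A \<or> superresolution_op loc A"
  shows "A *v 1 \<noteq> 0"
proof -
  have blurred: "(sampling_matrix \<sigma> ** B) *v 1 \<noteq> 0" if blur: "is_blur loc B" for \<sigma> B
  proof -
    obtain c where "c > 0" "B *v 1 = c *\<^sub>R 1"
      using blur_one[OF blur] .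
    then show ?thesis
      by (auto simp: vec_eq_iff sampling_matrix_mult_vector simp flip: matrix_vector_mul_assoc)
  qed
  have "sampling_matrix \<sigma> *v 1 \<noteq> 0" for \<sigma>
    by (simp add: vec_eq_iff sampling_matrix_mult_vector)
  then show ?thesis
    using assms blurred
    unfolding inpainting_op_def deblurring_op_def superresolution_op_def by blast
qed

theorem corollary3p1:
  fixes W :: "real^'n^'n" and A :: "real^'n^'m" and b :: "real^'m" and l :: real
    and loc :: "'n \<Rightarrow> int^'d"
  assumes "psd_matrix W" and "stochastic_matrix W" and "irreducible_matrix W"
    and "inj loc"
    and "inpainting_op A \<or> deblurring_op loc A \<or> superresolution_op loc A"
    and "l > 0"
  shows "strongly_convex
    (\<lambda>x. ereal (1/2 * (norm (A *v x - b))\<^sup>2) + ereal l * \<phi> W x)"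
proof -
  define G where "G = pinv W ** (mat 1 - W)"
  define V where "V = range ((*v) W)"
  \<comment> \<open>The modulus is taken from this form instead of the one with \<open>G\<close>: it
    is positive on all nonzero vectors, so the whole unit sphere can be used. The comparison with
    \<open>G\<close> is made on \<open>V\<close>.\<close>
  define p where "p x = (norm (A *v x))\<^sup>2 + l * (x \<bullet> x - x \<bullet> (W *v x))" for x
  define h where "h x = 1/2 * (norm (A *v x - b))\<^sup>2 + l * (1/2 * (x \<bullet> (G *v x)))" for x
  have sym: "transpose W = W"
    using assms(1) by (simp add: psd_matrix_def)
  have V: "subspace V"
    unfolding V_def by (intro linear_subspace_image subspace_UNIV) simp
  have "continuous_on UNIV p"
    unfolding p_def by (intro continuous_intros)
  moreover have "p (c *\<^sub>R x) = c\<^sup>2 * p x" for c x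
    by (simp add: p_def matrix_vector_mult_scaleR power_mult_distrib power2_eq_square algebra_simps)
  moreover have "0 < p x" if "x \<noteq> 0" for x
  proof -
    have D: "0 \<le> x \<bullet> x - x \<bullet> (W *v x)"
      using dirichlet_form_nonneg[OF sym assms(2)] .
    have "A *v x \<noteq> 0" if D0: "x \<bullet> x - x \<bullet> (W *v x) = 0"
    proof -
      obtain c where "x = c *\<^sub>R 1"
        using dirichlet_form_eq_0_imp_constant[OF sym assms(2,3) D0] .
      then show ?thesis
        using forward_op_one[OF assms(5)] \<open>x \<noteq> 0\<close> by (simp add: matrix_vector_mult_scaleR)
    qed
    then show ?thesis
      using D \<open>l > 0\<close> unfolding p_def
      by (cases "x \<bullet> x - x \<bullet> (W *v x) = 0") (auto intro!: add_nonneg_pos)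
  qed
  ultimately obtain \<mu> where \<mu>: "\<mu> > 0" "\<And>x. \<mu> * (norm x)\<^sup>2 \<le> p x"
    using positive_form_coercive by blast
  have "strongly_convex (\<lambda>x. ereal (h x) + indicator_fun V x)"
  proof (rule strongly_convex_add_indicator)
    show "continuous_on UNIV h"
      unfolding h_def by (intro continuous_intros)
    show "closed V" "convex V" "V \<noteq> {}"
      using V by (auto simp: closed_subspace subspace_imp_convex V_def)
    show "\<mu> > 0" by fact
    fix x y and \<theta> :: real
    assume "x \<in> V" "y \<in> V" and \<theta>: "\<theta> \<in> {0..1}"
    define d where "d = x - y"
    have A_comb: "(norm (A *v (\<theta> *\<^sub>R x + (1 - \<theta>) *\<^sub>R y) - b))\<^sup>2 =
        \<theta> * (norm (A *v x - b))\<^sup>2 + (1 - \<theta>) * (norm (A *v y - b))\<^sup>2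
          - \<theta> * (1 - \<theta>) * (norm (A *v d))\<^sup>2"
      by (simp only: matrix_vector_right_distrib matrix_vector_mult_scaleR d_def
          matrix_vector_mult_diff_distrib norm_diff_power2_convex_combination)
    have "d \<in> V"
      using V \<open>x \<in> V\<close> \<open>y \<in> V\<close> by (simp add: d_def subspace_diff)
    \<comment> \<open>The convexity gap of \<open>h\<close> is a multiple of the quadratic form at
      \<open>d\<close>, which lies in the subspace \<open>V\<close>, where the Dirichlet bound
      holds.\<close>
    then have "p d \<le> (norm (A *v d))\<^sup>2 + l * (d \<bullet> (G *v d))"
      using pinv_form_ge_dirichlet_form[OF assms(1)] \<open>l > 0\<close> by (simp add: p_def V_def G_def)
    then have "\<mu> * (norm d)\<^sup>2 \<le> (norm (A *v d))\<^sup>2 + l * (d \<bullet> (G *v d))"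
      using \<mu>(2) by (rule order_trans[rotated])
    then have "\<theta> * (1 - \<theta>) / 2 * (\<mu> * (norm d)\<^sup>2)
        \<le> \<theta> * (1 - \<theta>) / 2 * ((norm (A *v d))\<^sup>2 + l * (d \<bullet> (G *v d)))"
      using \<theta> by (intro mult_left_mono) auto
    moreover have "h (\<theta> *\<^sub>R x + (1 - \<theta>) *\<^sub>R y) = \<theta> * h x + (1 - \<theta>) * h y
        - \<theta> * (1 - \<theta>) / 2 * ((norm (A *v d))\<^sup>2 + l * (d \<bullet> (G *v d)))"
      unfolding h_def quadratic_form_convex_combination d_def[symmetric] A_comb
      by (simp add: field_simps)
    ultimately show "h (\<theta> *\<^sub>R x + (1 - \<theta>) *\<^sub>R y)
        \<le> \<theta> * h x + (1 - \<theta>) * h y - \<mu> / 2 * \<theta> * (1 - \<theta>) * (norm (x - y))\<^sup>2"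
      by (simp add: d_def mult_ac)
  qed
  \<comment> \<open>Positivity of \<open>l\<close> keeps \<open>ereal l * \<infinity>\<close>
    infinite, so the indicator survives the scaling.\<close>
  moreover have "ereal (1/2 * (norm (A *v x - b))\<^sup>2) + ereal l * \<phi> W x
      = ereal (h x) + indicator_fun V x" for x
    using \<open>l > 0\<close> by (simp add: \<phi>_def indicator_fun_def h_def G_def V_def)
  ultimately show ?thesis by simp
qed

end
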